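(* (i) Let $n\geq1$, let $\alpha:\mathbb{F}_2^n\to\mathbb{F}_2$ be a cubic form, and let $A\subset\mathbb{F}_2^n$ be a subset such that $\alpha(x+x')=1$ for all $x\neq x'$ in $A$. Then $|A|\leq\rho(2^n)$. (ii) This bound is sharp at least when $n\equiv1,2$ or $3\pmod 4$: for each such $n$ there exist a cubic form $\alpha$ on $\mathbb{F}_2^n$ and a subset $A\subset\mathbb{F}_2^n$ with $\alpha(x+x')=1$ for all distinct $x,x'\in A$ and $|A|=\rho(2^n)$.
   Context: A cubic form on $\mathbb{F}_2^n$ is a function $\alpha(x)=\sum_{1\leq i\leq j\leq k\leq n}\alpha_{ijk}x_ix_jx_k$ with $\alpha_{ijk}\in\mathbb{F}_2$, where $x=(x_1,\ldots,x_n)$ (so, since $x_i^2=x_i$ over $\mathbb{F}_2$, any polynomial function of degree at most $3$ without constant term). The Hurwitz-Radon function is given on powers of $2$ by $\rho(2^n)=2n+1$ if $n\equiv0\pmod4$, $\rho(2^n)=2n$ if $n\equiv1,2\pmod 4$, and $\rho(2^n)=2n+2$ if $n\equiv3\pmod4$. *)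

theory Defs
  imports
    "Jordan_Normal_Form.Matrix"
    "HOL-Library.Z2"
    "HOL-Computational_Algebra.Computational_Algebra"
begin

text \<open>\<open>bit\<close> is the field with two elements, and \<open>carrier_vec n :: bit vec set\<close> is the vector
  space \<open>F_2^n\<close>; coordinates are indexed by \<open>0, ..., n - 1\<close> rather than \<open>1, ..., n\<close>. Values of
  a form outside \<open>carrier_vec n\<close> are irrelevant.\<close>

definition cubic_form :: "nat \<Rightarrow> (bit vec \<Rightarrow> bit) \<Rightarrow> bool" where
  "cubic_form n \<alpha> \<longleftrightarrow>
     (\<exists>c :: nat \<Rightarrow> nat \<Rightarrow> nat \<Rightarrow> bit. \<forall>x \<in> carrier_vec n.
        \<alpha> x = (\<Sum>i = 0..<n. \<Sum>j = i..<n. \<Sum>k = j..<n. c i j k * x $ i * x $ j * x $ k))"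

text \<open>The Hurwitz-Radon function depends only on the 2-adic valuation of its argument, so its
  values at powers of 2 determine it at all positive integers.\<close>

definition hurwitz_radon :: "nat \<Rightarrow> nat" where
  "hurwitz_radon N =
     (let n = multiplicity 2 N in
      if n mod 4 = 0 then 2 * n + 1
      else if n mod 4 = 3 then 2 * n + 2
      else 2 * n)"

lemma hurwitz_radon_power2:
  "n mod 4 = 0 \<Longrightarrow> hurwitz_radon (2 ^ n) = 2 * n + 1"
  "n mod 4 \<in> {1, 2} \<Longrightarrow> hurwitz_radon (2 ^ n) = 2 * n"
  "n mod 4 = 3 \<Longrightarrow> hurwitz_radon (2 ^ n) = 2 * n + 2"
  by (auto simp: hurwitz_radon_def Let_def)

text \<open>Subsets of \<open>F_2^n\<close> are finite, so \<open>card\<close> is their true cardinality.\<close>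

lemma finite_carrier_vec_bit: "finite (carrier_vec n :: bit vec set)"
proof (rule finite_subset)
  show "(carrier_vec n :: bit vec set) \<subseteq> vec_of_list ` {xs. set xs \<subseteq> UNIV \<and> length xs = n}"
  proof
    fix x :: "bit vec"
    assume "x \<in> carrier_vec n"
    then show "x \<in> vec_of_list ` {xs. set xs \<subseteq> UNIV \<and> length xs = n}"
      by (intro image_eqI[of _ _ "list_of_vec x"]) (auto simp: vec_list)
  qed
  have "(UNIV :: bit set) = {0, 1}"
    by (auto intro: bit_not_one_iff[THEN iffD1])
  then have "finite (UNIV :: bit set)"
    by (metis finite.emptyI finite.insertI)
  then show "finite (vec_of_list ` {xs :: bit list. set xs \<subseteq> UNIV \<and> length xs = n})"
    by (intro finite_imageI finite_lists_length_eq)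
qed

end

(* Write the polarization of the cubic form alpha as F x . y + F y . x with F x . x = alpha x.
   After translating A so that 0 is in A, the nonzero x in A give vectors (x, F x) of F_2^(2n)
   on which the hyperbolic quadratic form Q(x, u) = u . x is 1 and whose polar values are 1.
   An even number r of such vectors has 2^r distinct subset sums, so r <= 2n. If r = 2n, the
   subset sums exhaust F_2^(2n), and Q at a sum of s vectors is s (s + 1) / 2, so comparing the
   Gauss sum of Q with that of the hyperbolic form forces n = 0, 3 mod 4; a further vector would
   be the sum of the 2n others, and Q = 1 there forces n odd.

   For sharpness, let alpha be 1 exactly on the vectors whose weight is not divisible by 4.
   If n = 3 mod 4, take all vectors of weight at most 1 and their complements; otherwise take
   the vectors of weight at most 1 supported off one coordinate, with that coordinate 0 or 1. *)

theory Submission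
  imports Defs
begin

declare add_bit_eq_xor [simp del] mult_bit_eq_and [simp del] minus_bit_def [simp del]

section \<open>Signs and Gauss sums over the field with two elements\<close>

definition bit_sign :: "bit \<Rightarrow> int" where
  "bit_sign b = (if b = 0 then 1 else - 1)"

lemma bit_sign_simps [simp]: "bit_sign 0 = 1" "bit_sign 1 = - 1"
  by (simp_all add: bit_sign_def)

lemma bit_add_self [simp]: "a + a = (0 :: bit)"
  by (metis bit_2_eq_0 mult_2 mult_zero_left)

lemma bit_mult_self [simp]: "a * a = (a :: bit)"
  by (cases a) simp_all

lemma bit_sign_add: "bit_sign (a + b) = bit_sign a * bit_sign b"
  by (cases a; cases b) simp_all

lemma of_nat_bit: "of_nat k = (of_bool (odd k) :: bit)"
  by (induction k) auto

section \<open>Character sums over F_2^n and the Gauss sum of the hyperbolic form\<close>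

definition ind_vec :: "nat \<Rightarrow> nat set \<Rightarrow> bit vec" where
  "ind_vec n S = vec n (\<lambda>i. of_bool (i \<in> S))"

lemma ind_vec_carrier [simp]: "ind_vec n S \<in> carrier_vec n"
  by (simp add: ind_vec_def)

lemma bij_betw_ind_vec: "bij_betw (ind_vec n) (Pow {..<n}) (carrier_vec n)"
proof (rule bij_betw_byWitness[where f' = "\<lambda>x :: bit vec. {i. i < n \<and> x $ i = 1}"])
  show "\<forall>x\<in>carrier_vec n. ind_vec n {i. i < n \<and> x $ i = 1} = x"
    by (auto simp: ind_vec_def intro!: eq_vecI)
qed (auto simp: ind_vec_def)

lemma card_carrier_vec_bit: "card (carrier_vec n :: bit vec set) = 2 ^ n"
  using bij_betw_same_card[OF bij_betw_ind_vec[of n]] by (simp add: card_Pow)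

lemma add_vec_cancel:
  "x \<in> carrier_vec n \<Longrightarrow> y \<in> carrier_vec n \<Longrightarrow> (x + y) + y = (x :: bit vec)"
  by (intro eq_vecI) (auto simp: add.assoc)

text \<open>Translating u by a unit vector at a coordinate where x is 1 flips every sign, so for
  nonzero x the sum equals its own negative.\<close>

lemma character_sum:
  assumes x: "x \<in> carrier_vec n"
  shows "(\<Sum>u\<in>carrier_vec n. bit_sign (u \<bullet> x)) = (if x = 0\<^sub>v n then 2 ^ n else 0)"
proof (cases "x = 0\<^sub>v n")
  case True
  then show ?thesis by (simp add: card_carrier_vec_bit)
next
  case False
  then obtain i where i: "i < n" "x $ i = 1"
    using x by (metis bit_not_one_iff carrier_vecD eq_vecI index_zero_vec)
  let ?e = "unit_vec n i :: bit vec"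
  have "(\<Sum>u\<in>carrier_vec n. bit_sign (u \<bullet> x)) = (\<Sum>u\<in>carrier_vec n. bit_sign ((u + ?e) \<bullet> x))"
    by (rule sum.reindex_bij_witness[where i = "\<lambda>u. u + ?e" and j = "\<lambda>u. u + ?e"])
       (auto simp: add_vec_cancel[where n = n] simp del: assoc_add_vec)
  also have "\<dots> = (\<Sum>u\<in>carrier_vec n. - bit_sign (u \<bullet> x))"
    using x i by (intro sum.cong) (auto simp: add_scalar_prod_distrib[where n = n] bit_sign_add)
  finally show ?thesis using False by (simp add: sum_negf)
qed

lemma gauss_sum:
  "(\<Sum>(x, u)\<in>carrier_vec n \<times> carrier_vec n. bit_sign (u \<bullet> x)) = 2 ^ n"
  using finite_carrier_vec_bit[of n]
  by (simp flip: sum.cartesian_product add: character_sum sum.delta)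

text \<open>The triangular number k(k+1)/2 modulo 2: k values of a quadratic form plus (k choose 2)
  polar values, all equal to 1.\<close>

definition tri :: "nat \<Rightarrow> bit" where
  "tri k = of_nat (\<Sum>{..k})"

lemma tri_0 [simp]: "tri 0 = 0" by (simp add: tri_def)

lemma tri_Suc: "tri (Suc k) = tri k + of_nat (Suc k)"
  unfolding tri_def by (simp only: sum.atMost_Suc of_nat_add)

lemma tri_add_2: "tri (k + 2) = tri k + 1"
  by (simp add: tri_Suc of_nat_bit)

lemma sum_Pow_insert:
  assumes "finite I" "i \<notin> I"
  shows "(\<Sum>S\<in>Pow (insert i I). f S) = (\<Sum>S\<in>Pow I. f S + f (insert i S) :: int)"
proof -
  have "inj_on (insert i) (Pow I)" "Pow I \<inter> insert i ` Pow I = {}"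
    using assms(2) by (auto intro!: inj_onI)
  then show ?thesis
    using assms(1) by (simp add: Pow_insert sum.union_disjoint sum.reindex sum.distrib)
qed

text \<open>This is \<open>(1 + i)^(2n) = 2^n i^n\<close>, twisted by \<open>i^j\<close>, read off from real and imaginary parts.\<close>

lemma sum_bit_sign_tri:
  assumes "finite I" "card I = 2 * n"
  shows "(\<Sum>S\<in>Pow I. bit_sign (tri (card S + j))) = 2 ^ n * bit_sign (tri (n + j))"
  using assms
proof (induction n arbitrary: I j)
  case 0
  then show ?case by simp
next
  case (Suc n)
  have "card I = Suc (Suc (2 * n))" using Suc.prems by simp
  then obtain a b I' where I: "I = insert a (insert b I')" "a \<notin> insert b I'" "b \<notin> I'"
      "card I' = 2 * n"
    by (metis card_Suc_eq)
  have fin: "finite I'" using I Suc.prems by simp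
  \<comment> \<open>Group subsets by their trace on \<open>I'\<close>. Adding both a and b flips the
    sign, cancelling the term with neither; the two terms with exactly one of them agree.\<close>
  have *: "(\<Sum>S\<in>Pow I'. bit_sign (tri (card S + j)) + bit_sign (tri (card (insert b S) + j))
       + (bit_sign (tri (card (insert a S) + j)) + bit_sign (tri (card (insert a (insert b S)) + j))))
    = (\<Sum>S\<in>Pow I'. 2 * bit_sign (tri (card S + Suc j)))"
  proof (rule sum.cong[OF refl])
    fix S assume "S \<in> Pow I'"
    then have "finite S" "a \<notin> insert b S" "b \<notin> S"
      using fin I finite_subset by auto
    then show "bit_sign (tri (card S + j)) + bit_sign (tri (card (insert b S) + j))
       + (bit_sign (tri (card (insert a S) + j)) + bit_sign (tri (card (insert a (insert b S)) + j)))
       = 2 * bit_sign (tri (card S + Suc j))"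
      using tri_add_2[of "card S + j"] by (simp add: bit_sign_add)
  qed
  have "(\<Sum>S\<in>Pow I. bit_sign (tri (card S + j))) = (\<Sum>S\<in>Pow I'. 2 * bit_sign (tri (card S + Suc j)))"
    using I fin * by (simp add: sum_Pow_insert sum.distrib insert_commute)
  also have "\<dots> = 2 * (2 ^ n * bit_sign (tri (n + Suc j)))"
    using Suc.IH[OF fin I(4), of "Suc j"] by (simp flip: sum_distrib_left)
  finally show ?case by simp
qed

text \<open>Two steps flip the value, so the pattern 0, 1, 1, 0 repeats with period 4.\<close>

lemma tri_eq_0_iff: "tri k = 0 \<longleftrightarrow> k mod 4 \<in> {0, 3}"
proof (induction k rule: less_induct)
  case (less k)
  consider "k < 2" | m where "k = m + 2"
    by (metis add.commute le_Suc_ex not_less)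
  then show ?case
  proof cases
    case 1
    then have "k = 0 \<or> k = 1" by auto
    then show ?thesis by (auto simp: tri_Suc[of 0, simplified])
  next
    case 2
    have "tri k = 0 \<longleftrightarrow> tri m \<noteq> 0"
      unfolding 2 tri_add_2 by (cases "tri m") auto
    also have "\<dots> \<longleftrightarrow> m mod 4 \<notin> {0, 3}" using less[of m] 2 by simp
    also have "\<dots> \<longleftrightarrow> k mod 4 \<in> {0, 3}" unfolding 2 by simp presburger
    finally show ?thesis .
  qed
qed

section \<open>Anticommuting families\<close>

text \<open>Formed coordinatewise in a fixed dimension \<open>n\<close>, so that the empty sum is
  the zero vector of the right dimension.\<close>

definition vec_sum :: "nat \<Rightarrow> ('i \<Rightarrow> bit vec) \<Rightarrow> 'i set \<Rightarrow> bit vec" where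
  "vec_sum n f S = vec n (\<lambda>k. \<Sum>i\<in>S. f i $ k)"

lemma vec_sum_carrier [simp]: "vec_sum n f S \<in> carrier_vec n"
  by (simp add: vec_sum_def)

lemma vec_sum_empty [simp]: "vec_sum n f {} = 0\<^sub>v n"
  by (auto simp: vec_sum_def)

lemma vec_sum_insert:
  assumes "finite S" "i \<notin> S" "f i \<in> carrier_vec n"
  shows "vec_sum n f (insert i S) = f i + vec_sum n f S"
  using assms by (intro eq_vecI) (auto simp: vec_sum_def)

lemma vec_sum_scalar_prod:
  assumes "y \<in> carrier_vec n"
  shows "vec_sum n f S \<bullet> y = (\<Sum>i\<in>S. f i \<bullet> y)"
  using assms by (simp add: vec_sum_def scalar_prod_def sum_distrib_right sum.swap[of _ S])

text \<open>The pairs \<open>(p i, q i)\<close> are vectors of \<open>F_2^(2n)\<close> on which the hyperbolic quadratic form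
  \<open>(x, u) \<mapsto> u \<bullet> x\<close> and its polar form take the value 1. In terms of Hurwitz-Radon theory they are
  elements of an extraspecial group that square to \<open>-1\<close> and anticommute.\<close>

locale anticommuting_family =
  fixes n :: nat and I :: "'i set" and p q :: "'i \<Rightarrow> bit vec"
  assumes finite_I: "finite I"
    and p_carrier: "i \<in> I \<Longrightarrow> p i \<in> carrier_vec n"
    and q_carrier: "i \<in> I \<Longrightarrow> q i \<in> carrier_vec n"
    and quad: "i \<in> I \<Longrightarrow> q i \<bullet> p i = 1"
    and polar: "i \<in> I \<Longrightarrow> j \<in> I \<Longrightarrow> i \<noteq> j \<Longrightarrow> q i \<bullet> p j + q j \<bullet> p i = 1"
begin

lemma subfamily: "J \<subseteq> I \<Longrightarrow> anticommuting_family n J p q"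
  using finite_I p_carrier q_carrier quad polar finite_subset
  by unfold_locales (auto simp: subset_iff)

text \<open>By bilinearity each i in S contributes its polar value with b: 1 for i distinct from b,
  and twice the same bit, hence 0, for i = b.\<close>

lemma polar_vec_sum:
  assumes "S \<subseteq> I" "b \<in> I"
  shows "vec_sum n q S \<bullet> p b + q b \<bullet> vec_sum n p S = of_nat (card (S - {b}))"
proof -
  have fin: "finite S" using assms finite_I finite_subset by auto
  have "q b \<bullet> vec_sum n p S = (\<Sum>i\<in>S. p i \<bullet> q b)"
    using assms q_carrier
    by (simp add: comm_scalar_prod[OF q_carrier vec_sum_carrier] vec_sum_scalar_prod)
  also have "\<dots> = (\<Sum>i\<in>S. q b \<bullet> p i)"
    using assms p_carrier q_carrier by (intro sum.cong comm_scalar_prod) auto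
  finally have "vec_sum n q S \<bullet> p b + q b \<bullet> vec_sum n p S = (\<Sum>i\<in>S. q i \<bullet> p b + q b \<bullet> p i)"
    using assms p_carrier by (simp add: vec_sum_scalar_prod sum.distrib)
  also have "\<dots> = (\<Sum>i\<in>S. of_bool (i \<noteq> b))"
    using assms by (intro sum.cong) (auto simp: polar)
  also have "\<dots> = (\<Sum>i\<in>S - {b}. 1)"
    using fin by (intro sum.mono_neutral_cong_right) auto
  finally show ?thesis by simp
qed

text \<open>Adjoining b to S adds Q(b) = 1 and the polar value card S, which is the increment of
  \<open>tri\<close>.\<close>

lemma quad_vec_sum:
  assumes "S \<subseteq> I"
  shows "vec_sum n q S \<bullet> vec_sum n p S = tri (card S)"
proof -
  have "finite S" using assms finite_I finite_subset by auto
  then show ?thesis using assms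
  proof induction
    case empty
    then show ?case by simp
  next
    case (insert b S)
    then have b: "b \<in> I" "S \<subseteq> I" "p b \<in> carrier_vec n" "q b \<in> carrier_vec n"
      using p_carrier q_carrier by auto
    have "vec_sum n q (insert b S) \<bullet> vec_sum n p (insert b S)
      = q b \<bullet> p b + vec_sum n q S \<bullet> vec_sum n p S
        + (vec_sum n q S \<bullet> p b + q b \<bullet> vec_sum n p S)"
      using insert.hyps b
      by (simp add: vec_sum_insert add_scalar_prod_distrib[where n = n]
          scalar_prod_add_distrib[where n = n] ac_simps)
    also have "\<dots> = 1 + tri (card S) + of_nat (card S)"
      using insert b by (simp add: quad polar_vec_sum)
    finally show ?case using insert.hyps by (simp add: tri_Suc ac_simps)
  qed
qed

section \<open>Subset sums and the possible sizes of a family\<close>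

abbreviation span_map :: "'i set \<Rightarrow> bit vec \<times> bit vec" where
  "span_map S \<equiv> (vec_sum n p S, vec_sum n q S)"

lemma span_map_eqD:
  assumes "S \<subseteq> I" "T \<subseteq> I" "span_map S = span_map T" "b \<in> I"
  shows "even (card (S - {b})) \<longleftrightarrow> even (card (T - {b}))"
  using polar_vec_sum[of S b] polar_vec_sum[of T b] assms
  by (auto simp: of_nat_bit split: if_splits)

text \<open>Pairing with each b recovers the parity of S - {b}, hence S up to complement in I.
  Complementary sets of different parity would make card I odd.\<close>

lemma inj_on_span_map:
  assumes "even (card I)"
  shows "inj_on span_map (Pow I)"
proof (rule inj_onI)
  fix S T assume S: "S \<in> Pow I" and T: "T \<in> Pow I" and eq: "span_map S = span_map T"
  have fin: "finite S" "finite T" using S T finite_I finite_subset by auto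
  have *: "(even (card S) \<longleftrightarrow> b \<notin> S) \<longleftrightarrow> (even (card T) \<longleftrightarrow> b \<notin> T)" if "b \<in> I" for b
  proof -
    have "even (card (R - {b})) \<longleftrightarrow> (even (card R) \<longleftrightarrow> b \<notin> R)" if "finite R" for R
      using that by (cases "b \<in> R") (auto simp: card_Diff_singleton card_gt_0_iff)
    then show ?thesis using span_map_eqD[of S T b] S T eq fin that by auto
  qed
  show "S = T"
  proof (cases "even (card S) \<longleftrightarrow> even (card T)")
    case True
    then show ?thesis using * S T by blast
  next
    case False
    then have "T = I - S" using * S T by blast
    then have "card I = card S + card T"
      using S finite_I fin by (simp add: card_Diff_subset card_mono)
    then show ?thesis using False assms by auto
  qed
qed

lemma span_map_subset: "span_map ` Pow I \<subseteq> carrier_vec n \<times> carrier_vec n"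
  by auto

lemma card_le_even:
  assumes "even (card I)"
  shows "card I \<le> 2 * n"
proof -
  have "2 ^ card I = card (span_map ` Pow I)"
    using assms finite_I by (simp add: card_image inj_on_span_map card_Pow)
  also have "\<dots> \<le> card ((carrier_vec n :: bit vec set) \<times> (carrier_vec n :: bit vec set))"
    by (intro card_mono span_map_subset finite_cartesian_product finite_carrier_vec_bit)
  also have "\<dots> = 2 ^ (2 * n)"
    by (simp add: card_cartesian_product card_carrier_vec_bit mult_2 power_add)
  finally show ?thesis by simp
qed

lemma bij_betw_span_map:
  assumes "card I = 2 * n"
  shows "bij_betw span_map (Pow I) (carrier_vec n \<times> carrier_vec n)"
proof -
  have inj: "inj_on span_map (Pow I)" using assms by (intro inj_on_span_map) simp
  moreover have "span_map ` Pow I = carrier_vec n \<times> carrier_vec n"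
    using assms finite_I
    by (intro card_subset_eq span_map_subset finite_cartesian_product finite_carrier_vec_bit)
       (simp add: card_image[OF inj] card_cartesian_product card_carrier_vec_bit card_Pow
         mult_2 power_add)
  ultimately show ?thesis by (simp add: bij_betw_def)
qed

text \<open>The Gauss sum is evaluated twice, over pairs of vectors and over subset sums; its sign,
  the Arf invariant, must agree.\<close>

lemma card_eq_2n_imp:
  assumes "card I = 2 * n"
  shows "n mod 4 \<in> {0, 3}"
proof -
  have "(2 :: int) ^ n = (\<Sum>S\<in>Pow I. bit_sign (vec_sum n q S \<bullet> vec_sum n p S))"
    using sum.reindex_bij_betw[OF bij_betw_span_map[OF assms], of "\<lambda>(x, u). bit_sign (u \<bullet> x)"]
    by (simp add: gauss_sum)
  also have "\<dots> = (\<Sum>S\<in>Pow I. bit_sign (tri (card S + 0)))"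
    by (intro sum.cong) (auto simp: quad_vec_sum)
  also have "\<dots> = 2 ^ n * bit_sign (tri n)"
    using sum_bit_sign_tri[OF finite_I assms, of 0] by simp
  finally have "tri n = 0" by (cases "tri n") auto
  then show ?thesis by (simp only: tri_eq_0_iff)
qed

text \<open>The vector left over is the sum of the \<open>2n\<close> others, which determines the value of the
  quadratic form at it.\<close>

lemma card_eq_2n_plus_1_imp:
  assumes "card I = 2 * n + 1"
  shows "odd n"
proof -
  have "I \<noteq> {}" using assms by auto
  then obtain a where a: "a \<in> I" by blast
  let ?J = "I - {a}"
  interpret J: anticommuting_family n ?J p q by (rule subfamily) auto
  have J: "card ?J = 2 * n" using a assms finite_I by simp
  have "(p a, q a) \<in> (\<lambda>S. (vec_sum n p S, vec_sum n q S)) ` Pow ?J"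
    using J.bij_betw_span_map[OF J] p_carrier[OF a] q_carrier[OF a]
    unfolding bij_betw_def by blast
  then obtain S where S: "S \<subseteq> ?J" "p a = vec_sum n p S" "q a = vec_sum n q S"
    by blast
  have fin: "finite S" using S(1) finite_I finite_subset by blast
  have *: "odd (card (S - {b}))" if b: "b \<in> ?J" for b
  proof -
    have "of_nat (card (S - {b})) = q a \<bullet> p b + q b \<bullet> p a"
      unfolding S(2,3) by (rule J.polar_vec_sum[OF S(1) b, symmetric])
    also have "\<dots> = 1" using a b by (intro polar) auto
    finally show ?thesis by (simp add: of_nat_bit split: if_splits)
  qed
  \<comment> \<open>If card S is even, a b outside S would leave S - {b} even; if card S is odd, any
    b in S would.\<close>
  have "S = ?J"
  proof (cases "even (card S)")
    case True
    have "b \<in> S" if "b \<in> ?J" for b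
    proof (rule ccontr)
      assume "b \<notin> S"
      then show False using *[OF that] True by simp
    qed
    then show ?thesis using S(1) by blast
  next
    case False
    then have "S \<noteq> {}" by auto
    then obtain b where b: "b \<in> S" by blast
    then have "even (card (S - {b}))" using False fin by simp
    then show ?thesis using *[of b] S(1) b by blast
  qed
  then have "tri (2 * n) = 1"
    using J.quad_vec_sum[OF S(1)] quad[OF a] J unfolding S(2,3) by simp
  then have "(2 * n) mod 4 \<noteq> 0" using tri_eq_0_iff[of "2 * n"] by simp
  then show ?thesis by presburger
qed

text \<open>The inequality is strict because a family will arise from a set A with one point
  removed. Larger families are cut down to the critical sizes 2n + 2 and 2n.\<close>

lemma card_less_hurwitz_radon: "card I < hurwitz_radon (2 ^ n)"
proof -
  have sub: "\<exists>J. J \<subseteq> I \<and> card J = m \<and> anticommuting_family n J p q" if "m \<le> card I" for m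
    using obtain_subset_with_card_n[OF that] subfamily by metis
  have 1: "card I < 2 * n + 2"
  proof (rule ccontr)
    assume "\<not> ?thesis"
    then obtain J where "card J = 2 * n + 2" "anticommuting_family n J p q"
      using sub[of "2 * n + 2"] by auto
    then show False using anticommuting_family.card_le_even[of n J p q] by simp
  qed
  have 2: "n mod 4 \<in> {0, 3}" if "2 * n \<le> card I"
    using sub[OF that] anticommuting_family.card_eq_2n_imp by blast
  have 3: "odd n" if "card I = 2 * n + 1"
    using card_eq_2n_plus_1_imp[OF that] .
  have "n mod 4 < 4" by simp
  then consider "n mod 4 = 0" | "n mod 4 \<in> {1, 2}" | "n mod 4 = 3"
    unfolding insert_iff by linarith
  then show ?thesis
  proof cases
    case n: 1
    then have "even n" by presburger
    then have "card I < 2 * n + 1" using 1 3 by linarith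
    then show ?thesis using n by (simp add: hurwitz_radon_power2)
  next
    case n: 2
    then have "\<not> 2 * n \<le> card I" using 2 by auto
    then show ?thesis using n by (simp add: hurwitz_radon_power2)
  next
    case n: 3
    then show ?thesis using 1 by (simp add: hurwitz_radon_power2)
  qed
qed

end

section \<open>Twisting functions of cubic forms\<close>

text \<open>The map \<open>F\<close> encodes the twisting function \<open>f(x, y) = F x \<bullet> y\<close>, linear in \<open>y\<close>, of the
  algebra with generating function \<open>\<alpha>\<close>.\<close>

definition twisted :: "nat \<Rightarrow> (bit vec \<Rightarrow> bit) \<Rightarrow> (bit vec \<Rightarrow> bit vec) \<Rightarrow> bool" where
  "twisted n \<alpha> F \<longleftrightarrow> (\<forall>x\<in>carrier_vec n. F x \<in> carrier_vec n \<and> F x \<bullet> x = \<alpha> x \<and>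
     (\<forall>y\<in>carrier_vec n. \<alpha> (x + y) = \<alpha> x + \<alpha> y + (F x \<bullet> y + F y \<bullet> x)))"

text \<open>The conditions are additive in the pair (\<alpha>, F), which reduces cubic forms to
  monomials.\<close>

lemma twisted_sum:
  assumes "\<And>s. s \<in> S \<Longrightarrow> \<exists>F. twisted n (\<alpha> s) F"
  shows "\<exists>F. twisted n (\<lambda>x. \<Sum>s\<in>S. \<alpha> s x) F"
proof -
  obtain F where "\<And>s. s \<in> S \<Longrightarrow> twisted n (\<alpha> s) (F s)"
    using assms by metis
  then have "twisted n (\<lambda>x. \<Sum>s\<in>S. \<alpha> s x) (\<lambda>x. vec_sum n (\<lambda>s. F s x) S)"
    by (auto simp: twisted_def vec_sum_scalar_prod simp flip: sum.distrib intro!: sum.cong)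
  then show ?thesis by blast
qed

text \<open>The six mixed terms are grouped as three linear in the primed variables and three linear
  in the unprimed ones, giving F x . y and F y . x.\<close>

lemma cubic_polarization:
  fixes a b d a' b' d' c :: bit
  shows "c * (a + a') * (b + b') * (d + d') = c * a * b * d + c * a' * b' * d'
    + ((c * a * b * d' + (c * a * d * b' + c * b * d * a'))
      + (c * a' * b' * d + (c * a' * d' * b + c * b' * d' * a)))"
  by (cases a; cases b; cases d; cases a'; cases b'; cases d'; simp)

lemma twisted_monomial:
  assumes "i < n" "j < n" "k < n"
  shows "\<exists>F. twisted n (\<lambda>x :: bit vec. c * x $ i * x $ j * x $ k) F"
proof -
  \<comment> \<open>The formal gradient of the monomial. Its product with x is three copies of the
    monomial, hence one modulo 2.\<close>
  let ?F = "\<lambda>x :: bit vec. (c * x $ i * x $ j) \<cdot>\<^sub>v unit_vec n k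
    + ((c * x $ i * x $ k) \<cdot>\<^sub>v unit_vec n j + (c * x $ j * x $ k) \<cdot>\<^sub>v unit_vec n i)"
  have F: "?F x \<bullet> y = c * x $ i * x $ j * y $ k + (c * x $ i * x $ k * y $ j + c * x $ j * x $ k * y $ i)"
    if "x \<in> carrier_vec n" "y \<in> carrier_vec n" for x y
    using that assms by (simp add: add_scalar_prod_distrib[where n = n])
  have "twisted n (\<lambda>x :: bit vec. c * x $ i * x $ j * x $ k) ?F"
    unfolding twisted_def
  proof (intro ballI conjI)
    fix x y :: "bit vec" assume x: "x \<in> carrier_vec n" and y: "y \<in> carrier_vec n"
    show "?F x \<in> carrier_vec n" by simp
    show "?F x \<bullet> x = c * x $ i * x $ j * x $ k"
      unfolding F[OF x x] by (cases "x $ i"; cases "x $ j"; cases "x $ k"; cases c) simp_all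
    show "c * (x + y) $ i * (x + y) $ j * (x + y) $ k
      = c * x $ i * x $ j * x $ k + c * y $ i * y $ j * y $ k + (?F x \<bullet> y + ?F y \<bullet> x)"
      unfolding F[OF x y] F[OF y x] using x y assms by (simp add: cubic_polarization)
  qed
  then show ?thesis by blast
qed

lemma cubic_form_twisted:
  assumes "cubic_form n \<alpha>"
  obtains F where "twisted n \<alpha> F"
proof -
  obtain c where c: "\<And>x. x \<in> carrier_vec n \<Longrightarrow>
      \<alpha> x = (\<Sum>i = 0..<n. \<Sum>j = i..<n. \<Sum>k = j..<n. c i j k * x $ i * x $ j * x $ k)"
    using assms by (auto simp: cubic_form_def)
  have "\<exists>F. twisted n
      (\<lambda>x. \<Sum>i = 0..<n. \<Sum>j = i..<n. \<Sum>k = j..<n. c i j k * x $ i * x $ j * x $ k) F"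
    by (intro twisted_sum twisted_monomial) auto
  then obtain F where "twisted n
      (\<lambda>x. \<Sum>i = 0..<n. \<Sum>j = i..<n. \<Sum>k = j..<n. c i j k * x $ i * x $ j * x $ k) F" ..
  then have "twisted n \<alpha> F"
    by (simp add: twisted_def c)
  then show ?thesis by (rule that)
qed

lemma card_le_hurwitz_radon:
  assumes "cubic_form n \<alpha>" "A \<subseteq> carrier_vec n"
    and one: "\<And>x x'. x \<in> A \<Longrightarrow> x' \<in> A \<Longrightarrow> x \<noteq> x' \<Longrightarrow> \<alpha> (x + x') = 1"
  shows "card A \<le> hurwitz_radon (2 ^ n)"
proof (cases "A = {}")
  case False
  then obtain a where a: "a \<in> A" by blast
  obtain F where F: "twisted n \<alpha> F" using cubic_form_twisted assms(1) .
  have car: "x \<in> carrier_vec n" if "x \<in> A" for x using assms(2) that by blast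
  have fin: "finite A" using assms(2) finite_carrier_vec_bit finite_subset by blast
  have "anticommuting_family n (A - {a}) (\<lambda>x. x + a) (\<lambda>x. F (x + a))"
  proof
    show "finite (A - {a})" using fin by simp
    fix x assume x: "x \<in> A - {a}"
    then show xa: "x + a \<in> carrier_vec n" using car a by auto
    then show "F (x + a) \<in> carrier_vec n" using F by (auto simp: twisted_def)
    show "F (x + a) \<bullet> (x + a) = 1"
      using F xa one[of x a] x a by (auto simp: twisted_def)
    fix y assume y: "y \<in> A - {a}" and "x \<noteq> y"
    have "(x + a) + (y + a) = x + y"
      using car[of x] car[of y] car[OF a] x y by (intro eq_vecI) (auto simp: ac_simps)
    moreover have "y + a \<in> carrier_vec n" using y car a by auto
    ultimately have "\<alpha> (x + y) = \<alpha> (x + a) + \<alpha> (y + a)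
        + (F (x + a) \<bullet> (y + a) + F (y + a) \<bullet> (x + a))"
      using F xa unfolding twisted_def by metis
    \<comment> \<open>All three values of \<alpha> are 1, so the polar value is 1 + 1 + 1 =
      1.\<close>
    then show "F (x + a) \<bullet> (y + a) + F (y + a) \<bullet> (x + a) = 1"
      using one[of x y] one[of x a] one[of y a] x y a \<open>x \<noteq> y\<close> by auto
  qed
  then have "card (A - {a}) < hurwitz_radon (2 ^ n)"
    by (rule anticommuting_family.card_less_hurwitz_radon)
  then show ?thesis using a fin by simp
qed simp

section \<open>Sharpness\<close>

lemma double_sum_Suc:
  fixes g :: "nat \<Rightarrow> nat \<Rightarrow> 'a :: comm_monoid_add"
  shows "(\<Sum>i = 0..<Suc n. \<Sum>j = i..<Suc n. g i j)
    = (\<Sum>i = 0..<n. \<Sum>j = i..<n. g i j) + (\<Sum>i = 0..<Suc n. g i n)"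
proof -
  have "(\<Sum>i = 0..<Suc n. \<Sum>j = i..<Suc n. g i j)
    = (\<Sum>i = 0..<Suc n. (\<Sum>j = i..<n. g i j) + g i n)"
    by (intro sum.cong) (auto simp: sum.atLeastLessThan_Suc)
  then show ?thesis by (simp add: sum.distrib ac_simps)
qed

text \<open>Separates the terms with largest index n, for evaluating forms one variable at a
  time.\<close>

lemma triple_sum_Suc:
  fixes g :: "nat \<Rightarrow> nat \<Rightarrow> nat \<Rightarrow> 'a :: comm_monoid_add"
  shows "(\<Sum>i = 0..<Suc n. \<Sum>j = i..<Suc n. \<Sum>k = j..<Suc n. g i j k)
    = (\<Sum>i = 0..<n. \<Sum>j = i..<n. \<Sum>k = j..<n. g i j k)
      + (\<Sum>i = 0..<Suc n. \<Sum>j = i..<Suc n. g i j n)"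
proof -
  have "(\<Sum>i = 0..<Suc n. \<Sum>j = i..<Suc n. \<Sum>k = j..<Suc n. g i j k)
    = (\<Sum>i = 0..<Suc n. \<Sum>j = i..<Suc n. (\<Sum>k = j..<n. g i j k) + g i j n)"
    by (intro sum.cong) (auto simp: sum.atLeastLessThan_Suc)
  also have "\<dots> = (\<Sum>i = 0..<Suc n. \<Sum>j = i..<Suc n. \<Sum>k = j..<n. g i j k)
      + (\<Sum>i = 0..<Suc n. \<Sum>j = i..<Suc n. g i j n)"
    by (simp only: sum.distrib)
  \<comment> \<open>For j = n the range of k is empty.\<close>
  also have "(\<Sum>i = 0..<Suc n. \<Sum>j = i..<Suc n. \<Sum>k = j..<n. g i j k)
    = (\<Sum>i = 0..<n. \<Sum>j = i..<n. \<Sum>k = j..<n. g i j k)"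
    by (subst double_sum_Suc) simp
  finally show ?thesis .
qed

definition weight :: "nat \<Rightarrow> (nat \<Rightarrow> bit) \<Rightarrow> nat" where
  "weight n a = card {i. i < n \<and> a i = 1}"

lemma weight_0 [simp]: "weight 0 a = 0"
  by (simp add: weight_def)

lemma weight_Suc: "weight (Suc n) a = weight n a + of_bool (a n = 1)"
proof -
  have "{i. i < Suc n \<and> a i = 1}
      = (if a n = 1 then insert n {i. i < n \<and> a i = 1} else {i. i < n \<and> a i = 1})"
    by (auto simp: less_Suc_eq)
  then show ?thesis by (simp add: weight_def)
qed

lemma sum_eq_weight: "(\<Sum>i = 0..<n. a i) = (of_nat (weight n a) :: bit)"
proof (induction n)
  case (Suc n)
  then show ?case by (cases "a n") (simp_all add: weight_Suc add.commute)
qed simp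

text \<open>The sum counts pairs i \<le> j in the support, w(w+1)/2 of them for weight w.\<close>

lemma quadratic_sum_eq_tri: "(\<Sum>i = 0..<n. \<Sum>j = i..<n. a i * a j) = tri (weight n a)"
proof (induction n)
  case (Suc n)
  have "(\<Sum>i = 0..<Suc n. a i * a n) = of_nat (weight (Suc n) a) * a n"
    by (simp only: sum_eq_weight flip: sum_distrib_right)
  then show ?case unfolding double_sum_Suc Suc.IH
    by (cases "a n") (simp_all add: weight_Suc tri_Suc)
qed simp

text \<open>The coefficients pick out the monomials counted by \<open>w + (w choose 2) + (w choose 3)\<close>,
  which is even iff 4 divides the weight \<open>w\<close>; each \<open>x\<^sub>i x\<^sub>k\<close> is taken only as \<open>(i, i, k)\<close>.\<close>

lemma cubic_sum_eq_weight:
  "(\<Sum>i = 0..<n. \<Sum>j = i..<n. \<Sum>k = j..<n. of_bool (i = j \<or> j < k) * a i * a j * a k)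
    = (of_bool (\<not> 4 dvd weight n a) :: bit)"
proof (induction n)
  case (Suc n)
  let ?w = "weight n a"
  \<comment> \<open>For j < n the coefficient is 1; for j = n only i = n survives, contributing a
    n.\<close>
  have "(\<Sum>i = 0..<Suc n. \<Sum>j = i..<Suc n. of_bool (i = j \<or> j < n) * a i * a j * a n)
    = (\<Sum>i = 0..<n. \<Sum>j = i..<n. a i * a j * a n) + a n"
    unfolding double_sum_Suc by simp
  also have "\<dots> = tri ?w * a n + a n"
    by (simp only: quadratic_sum_eq_tri flip: sum_distrib_right)
  finally have *: "(\<Sum>i = 0..<Suc n. \<Sum>j = i..<Suc n. \<Sum>k = j..<Suc n.
      of_bool (i = j \<or> j < k) * a i * a j * a k) = of_bool (\<not> 4 dvd ?w) + (tri ?w * a n + a n)"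
    unfolding triple_sum_Suc Suc.IH by simp
  show ?case
  proof (cases "a n = 0")
    case True
    then show ?thesis unfolding * by (simp add: weight_Suc)
  next
    case False
    \<comment> \<open>The added term \<open>tri ?w\<close> + 1 is 1 exactly for weights 0 and 3
      modulo 4, where divisibility by 4 changes on passing to the next weight.\<close>
    have "tri ?w = of_bool (?w mod 4 \<notin> {0, 3})"
      using tri_eq_0_iff[of ?w] by (cases "tri ?w") auto
    moreover have "4 dvd ?w \<longleftrightarrow> ?w mod 4 = 0" "4 dvd Suc ?w \<longleftrightarrow> ?w mod 4 = 3"
      by presburger+
    ultimately show ?thesis unfolding * using False by (simp add: weight_Suc)
  qed
qed simp

lemma cubic_form_weight: "cubic_form n (\<lambda>x. of_bool (\<not> 4 dvd weight n (($) x)))"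
  unfolding cubic_form_def 
  by (intro exI[of _ "\<lambda>i j k. of_bool (i = j \<or> j < k)"] ballI) (rule cubic_sum_eq_weight[symmetric])

lemma not_4_dvd: "\<not> 4 dvd k" if "0 < k" "k \<le> 3" for k :: nat
  using dvd_imp_le[of 4 k] that by linarith

lemma weight_ind_vec_add:
  assumes "S \<subseteq> {..<n}" "T \<subseteq> {..<n}"
  shows "weight n (($) (ind_vec n S + ind_vec n T)) = card (sym_diff S T)"
proof -
  have "{i. i < n \<and> (ind_vec n S + ind_vec n T) $ i = 1} = sym_diff S T"
    using assms by (auto simp: ind_vec_def)
  then show ?thesis by (simp add: weight_def)
qed

text \<open>Common frame of both constructions: g preserves symmetric differences, so only distances
  within B and between B and its image matter.\<close>

lemma ex_cubic_form_of_set_family: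
  assumes B: "B \<subseteq> Pow {..<n}" and g: "g ` B \<subseteq> Pow {..<n}"
    and B2: "\<And>S T. S \<in> B \<Longrightarrow> T \<in> B \<Longrightarrow> card (sym_diff S T) \<le> 2"
    and gg: "\<And>S T. S \<in> B \<Longrightarrow> T \<in> B \<Longrightarrow> sym_diff (g S) (g T) = sym_diff S T"
    and Bg: "\<And>S T. S \<in> B \<Longrightarrow> T \<in> B \<Longrightarrow> \<not> 4 dvd card (sym_diff S (g T))"
  shows "\<exists>\<alpha> A. cubic_form n \<alpha> \<and> A \<subseteq> carrier_vec n \<and>
    (\<forall>x\<in>A. \<forall>x'\<in>A. x \<noteq> x' \<longrightarrow> \<alpha> (x + x') = 1) \<and> card A = 2 * card B"
proof -
  let ?\<alpha> = "\<lambda>x :: bit vec. of_bool (\<not> 4 dvd weight n (($) x)) :: bit"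
  let ?F = "B \<union> g ` B"
  have F: "?F \<subseteq> Pow {..<n}" using B g by blast
  have fin: "finite B" using B by (rule finite_subset) simp
  have B4: "\<not> 4 dvd card (sym_diff S T)" if "S \<in> B" "T \<in> B" "S \<noteq> T" for S T
  proof -
    have "S \<subseteq> {..<n}" "T \<subseteq> {..<n}" using that B by blast+
    then have "finite (sym_diff S T)" by (blast intro: finite_subset[OF _ finite_lessThan])
    moreover have "sym_diff S T \<noteq> {}" using that(3) by blast
    ultimately have "0 < card (sym_diff S T)" by (simp only: card_gt_0_iff simp_thms)
    then show ?thesis using B2[OF that(1,2)] by (intro not_4_dvd) linarith+
  qed
  have F4: "\<not> 4 dvd card (sym_diff S T)" if ST: "S \<in> ?F" "T \<in> ?F" "S \<noteq> T" for S T
  proof -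
    consider "S \<in> B" "T \<in> B" | T' where "S \<in> B" "T' \<in> B" "T = g T'"
      | S' where "S' \<in> B" "T \<in> B" "S = g S'"
      | S' T' where "S' \<in> B" "T' \<in> B" "S = g S'" "T = g T'"
      using ST(1,2) by blast
    then show ?thesis
    proof cases
      case 1
      then show ?thesis using ST(3) by (intro B4)
    next
      case 2
      then show ?thesis using Bg by (simp only: not_False_eq_True)
    next
      case 3
      then show ?thesis using Bg[of T S'] by (simp only: Un_commute not_False_eq_True)
    next
      case 4
      then have "S' \<noteq> T'" using ST(3) by blast
      then show ?thesis using 4 B4[of S' T'] by (simp only: gg not_False_eq_True)
    qed
  qed
  have inj: "inj_on g B"
  proof (rule inj_onI)
    fix S T assume "S \<in> B" "T \<in> B" "g S = g T"
    then have "sym_diff S T = {}" using gg[of S T] by simp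
    then show "S = T" by blast
  qed
  \<comment> \<open>A common member would give an empty symmetric difference, and 4 divides
    0.\<close>
  have "B \<inter> g ` B = {}"
  proof (rule ccontr)
    assume "B \<inter> g ` B \<noteq> {}"
    then obtain S T where "S \<in> B" "T \<in> B" "S = g T" by blast
    then show False using Bg[of S T] by simp
  qed
  then have "card ?F = 2 * card B"
    using fin by (simp add: card_Un_disjoint card_image[OF inj])
  moreover have "inj_on (ind_vec n) ?F"
    using bij_betw_ind_vec[of n] F unfolding bij_betw_def by (blast intro: inj_on_subset)
  ultimately have "card (ind_vec n ` ?F) = 2 * card B"
    by (simp add: card_image)
  moreover have "?\<alpha> (x + x') = 1"
    if xx: "x \<in> ind_vec n ` ?F" "x' \<in> ind_vec n ` ?F" "x \<noteq> x'" for x x'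
  proof -
    obtain S T where ST: "S \<in> ?F" "T \<in> ?F" "x = ind_vec n S" "x' = ind_vec n T"
      using xx by blast
    then have "S \<subseteq> {..<n}" "T \<subseteq> {..<n}" "S \<noteq> T" using F xx(3) by blast+
    then show ?thesis using F4[OF ST(1,2)] ST(3,4) by (simp only: weight_ind_vec_add) simp
  qed
  moreover have "ind_vec n ` ?F \<subseteq> carrier_vec n" by (rule image_subsetI) simp
  ultimately show ?thesis
    using cubic_form_weight[of n] by (intro exI[of _ ?\<alpha>] exI[of _ "ind_vec n ` ?F"]) blast
qed

section \<open>The two extremal configurations\<close>

definition small_sets :: "nat set \<Rightarrow> nat set set" where
  "small_sets M = insert {} ((\<lambda>i. {i}) ` M)"

lemma card_small_sets: "finite M \<Longrightarrow> card (small_sets M) = Suc (card M)"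
  unfolding small_sets_def by (subst card_insert_disjoint) (auto simp: card_image)

lemma card_sym_diff_small_sets:
  assumes "S \<in> small_sets M" "T \<in> small_sets M"
  shows "card (sym_diff S T) \<le> 2"
proof -
  obtain i j where "sym_diff S T \<subseteq> {i, j}"
    using assms unfolding small_sets_def by blast
  then have "card (sym_diff S T) \<le> card {i, j}" by (intro card_mono) auto
  also have "\<dots> \<le> 2" by (simp add: card_insert_if)
  finally show ?thesis .
qed

lemma ex_cubic_form_card_2n:
  assumes "n \<ge> 1"
  shows "\<exists>\<alpha> A. cubic_form n \<alpha> \<and> A \<subseteq> carrier_vec n \<and>
    (\<forall>x\<in>A. \<forall>x'\<in>A. x \<noteq> x' \<longrightarrow> \<alpha> (x + x') = 1) \<and> card A = 2 * n"
proof -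
  let ?B = "small_sets {1..<n}"
  have "card ?B = n" using assms by (simp add: card_small_sets)
  moreover have "\<exists>\<alpha> A. cubic_form n \<alpha> \<and> A \<subseteq> carrier_vec n \<and>
    (\<forall>x\<in>A. \<forall>x'\<in>A. x \<noteq> x' \<longrightarrow> \<alpha> (x + x') = 1) \<and> card A = 2 * card ?B"
  proof (rule ex_cubic_form_of_set_family[where g = "insert 0"])
    show "?B \<subseteq> Pow {..<n}" "insert 0 ` ?B \<subseteq> Pow {..<n}"
      using assms by (auto simp: small_sets_def)
  next
    fix S T assume ST: "S \<in> ?B" "T \<in> ?B"
    then have 0: "0 \<notin> S" "0 \<notin> T" and fin: "finite S" "finite T"
      by (auto simp: small_sets_def)
    show "card (sym_diff S T) \<le> 2" using ST by (rule card_sym_diff_small_sets)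
    \<comment> \<open>Toggling the reserved coordinate 0 adds 1 to a distance of at most 2, so mixed
      distances lie between 1 and 3.\<close>
    then have "card (insert 0 (sym_diff S T)) \<le> 3" "0 < card (insert 0 (sym_diff S T))"
      using 0 fin by simp_all
    moreover have "sym_diff S (insert 0 T) = insert 0 (sym_diff S T)" using 0 by blast
    ultimately show "\<not> 4 dvd card (sym_diff S (insert 0 T))"
      by (simp only: not_4_dvd not_False_eq_True)
    show "sym_diff (insert 0 S) (insert 0 T) = sym_diff S T" using 0 by blast
  qed
  ultimately show ?thesis by simp
qed

lemma ex_cubic_form_card_2n_plus_2:
  assumes "n mod 4 = 3"
  shows "\<exists>\<alpha> A. cubic_form n \<alpha> \<and> A \<subseteq> carrier_vec n \<and>
    (\<forall>x\<in>A. \<forall>x'\<in>A. x \<noteq> x' \<longrightarrow> \<alpha> (x + x') = 1) \<and> card A = 2 * n + 2"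
proof -
  let ?B = "small_sets {..<n}"
  have "card ?B = Suc n" by (simp add: card_small_sets)
  moreover have "\<exists>\<alpha> A. cubic_form n \<alpha> \<and> A \<subseteq> carrier_vec n \<and>
    (\<forall>x\<in>A. \<forall>x'\<in>A. x \<noteq> x' \<longrightarrow> \<alpha> (x + x') = 1) \<and> card A = 2 * card ?B"
  proof (rule ex_cubic_form_of_set_family[where g = "\<lambda>S. {..<n} - S"])
    show "?B \<subseteq> Pow {..<n}" "(\<lambda>S. {..<n} - S) ` ?B \<subseteq> Pow {..<n}"
      by (auto simp: small_sets_def)
  next
    fix S T assume ST: "S \<in> ?B" "T \<in> ?B"
    then have sub: "S \<subseteq> {..<n}" "T \<subseteq> {..<n}" by (auto simp: small_sets_def)
    show le: "card (sym_diff S T) \<le> 2" using ST by (rule card_sym_diff_small_sets)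
    have "sym_diff S ({..<n} - T) = {..<n} - sym_diff S T" using sub by blast
    moreover have "sym_diff S T \<subseteq> {..<n}" using sub by blast
    ultimately have "card (sym_diff S ({..<n} - T)) = n - card (sym_diff S T)"
      using finite_subset[OF _ finite_lessThan] by (metis card_Diff_subset card_lessThan)
    \<comment> \<open>The distance is n - d with d \<le> 2, hence 3, 2 or 1 modulo 4.\<close>
    then show "\<not> 4 dvd card (sym_diff S ({..<n} - T))"
      using le assms by presburger
    show "sym_diff ({..<n} - S) ({..<n} - T) = sym_diff S T" using sub by blast
  qed
  ultimately show ?thesis by simp
qed

theorem theorem1p2:
  shows "(\<forall>n \<ge> 1. \<forall>(\<alpha> :: bit vec \<Rightarrow> bit) A.
            cubic_form n \<alpha> \<longrightarrow> A \<subseteq> carrier_vec n \<longrightarrow>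
            (\<forall>x \<in> A. \<forall>x' \<in> A. x \<noteq> x' \<longrightarrow> \<alpha> (x + x') = 1) \<longrightarrow>
            card A \<le> hurwitz_radon (2 ^ n)) \<and>
         (\<forall>n. n mod 4 \<in> {1, 2, 3} \<longrightarrow>
            (\<exists>(\<alpha> :: bit vec \<Rightarrow> bit) A.
               cubic_form n \<alpha> \<and> A \<subseteq> carrier_vec n \<and>
               (\<forall>x \<in> A. \<forall>x' \<in> A. x \<noteq> x' \<longrightarrow> \<alpha> (x + x') = 1) \<and>
               card A = hurwitz_radon (2 ^ n)))"
proof (intro conjI allI impI)
  fix n :: nat and \<alpha> :: "bit vec \<Rightarrow> bit" and A
  assume "n \<ge> 1" "cubic_form n \<alpha>" "A \<subseteq> carrier_vec n"
    "\<forall>x \<in> A. \<forall>x' \<in> A. x \<noteq> x' \<longrightarrow> \<alpha> (x + x') = 1"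
  then show "card A \<le> hurwitz_radon (2 ^ n)"
    by (intro card_le_hurwitz_radon[where \<alpha> = \<alpha>]) auto
next
  fix n :: nat
  assume n: "n mod 4 \<in> {1, 2, 3}"
  show "\<exists>(\<alpha> :: bit vec \<Rightarrow> bit) A. cubic_form n \<alpha> \<and> A \<subseteq> carrier_vec n \<and>
      (\<forall>x \<in> A. \<forall>x' \<in> A. x \<noteq> x' \<longrightarrow> \<alpha> (x + x') = 1) \<and> card A = hurwitz_radon (2 ^ n)"
  proof (cases "n mod 4 = 3")
    case True
    then show ?thesis
      using ex_cubic_form_card_2n_plus_2[OF True] by (simp only: hurwitz_radon_power2)
  next
    case False
    then have "n mod 4 \<in> {1, 2}" "n \<ge> 1" using n by auto
    then show ?thesis
      using ex_cubic_form_card_2n by (simp only: hurwitz_radon_power2)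
  qed
qed

end
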